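(* Let $\mathcal{X}=\mathbb{R}^n$, let $\mathcal{U}\subset\mathbb{R}^m$ be compact, let $K\subset K'\subseteq\mathcal{X}$ be Borel sets with $K$ bounded, let $\bar{\mathcal{X}}=K'\setminus K$, and assume that $K$ and $S:=\bar{\mathcal{X}}\times\mathcal{U}$ are quadratic sets in $\mathbb{R}^n$ and $\mathbb{R}^{n+m}$ respectively, described by $N$ symmetric matrices $K_1,\dots,K_N$ and $S_1,\dots,S_N$. Let the stochastic kernel $Q(\cdot|x,u)$ have density $q(y,x,u)=\phi(y,\mu_0(x,u),\Sigma_0)$ with $\mu_0(x,u)=Ax+Bu$, $A\in\mathbb{R}^{n\times n}$, $B\in\mathbb{R}^{n\times m}$, $\Sigma_0$ symmetric positive definite. Fix $k\in\{0,\dots,T-1\}$ and let $\hat V^*_{k+1}(x)=\sum_{i=1}^M w_i\phi(x,\mu_i,\Sigma_i)$ be a Gaussian RBF sum with $M\ge1$, $w_i>0$, satisfying $\hat V^*_{k+1}(x)\ge V^*_{k+1}(x)$ for all $x\in\mathcal{X}$, where $V^*_{k+1}$ is the reach-avoid value function. Let $\nu$ be a probability measure on $\mathcal{X}$. Consider the semidefinite program $$\begin{aligned}\min_{\hat\mu_i,\hat\Sigma_i,y_i,\tau_i,\rho_i}\quad&\sum_{i=1}^M y_i+\tfrac12\operatorname{tr}(\hat\Sigma_i)\\ \text{subject to}\quad& X_i\succcurlyeq0,\ \ \bar X_i\succcurlyeq0,\ \ \tau_i,\rho_i\in\mathbb{R}^N_{\ge0},\ \ y_i\in\mathbb{R},\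 \ \hat\mu_i\in\mathbb{R}^n,\ \ \hat\Sigma_i\in\mathbf S^n_+,\qquad i=1,\dots,M,\end{aligned}$$ where, with $\bar\Sigma_i=(\Sigma_i+\Sigma_0)^{-1}$, $$X_i=\begin{bmatrix}Q_{\hat\Sigma_i}^{-1}&Q_{\hat\mu_i}\\ Q_{\hat\mu_i}^\top&Q_i+Q_{\mu_i,\bar\Sigma_i}-\sum_{j=1}^N\tau_{i,j}S_j\end{bmatrix},\qquad \bar X_i=\begin{bmatrix}Q_{\hat\Sigma_i}^{-1}&Q_{\hat\mu_i}\\ Q_{\hat\mu_i}^\top&\bar Q_i-\sum_{j=1}^N\rho_{i,j}\tilde K_j\end{bmatrix},$$ $$Q_i=\begin{bmatrix}\mathbf0&\mathbf0&\mathbf0\\ \mathbf0&\mathbf0&\mathbf0\\ \mathbf0&\mathbf0&2\Big(y_i+\log\frac{\sqrt{|\Sigma_i+\Sigma_0|}}{w_i}\Big)\end{bmatrix},\quad Q_{\hat\mu_i}=\begin{bmatrix}\mathbf0&\mathbf0&\mathbf0\\ \mathbf0&\mathbf0&\mathbf0\\ I&\mathbf0&-\hat\mu_i\end{bmatrix},\quad Q_{\hat\Sigma_i}=\begin{bmatrix}I&\mathbf0&\mathbf0\\ \mathbf0&I&\mathbf0\\ \mathbf0&\mathbf0&\hat\Sigma_i^{-1}\end{bmatrix},$$ $$Q_{\mu_i,\bar\Sigma_i}=\begin{bmatrix}A^\top\bar\Sigma_iA&A^\top\bar\Sigma_iB&-A^\top\bar\Sigma_i\mu_i\\ B^\top\bar\Sigma_iA&B^\top\bar\Sigma_iB&-B^\top\bar\Sigma_i\mu_i\\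 -\mu_i^\top\bar\Sigma_iA&-\mu_i^\top\bar\Sigma_iB&\mu_i^\top\bar\Sigma_i\mu_i\end{bmatrix},\quad \bar Q_i=\begin{bmatrix}\mathbf0&\mathbf0&\mathbf0\\ \mathbf0&\mathbf0&\mathbf0\\ \mathbf0&\mathbf0&2\Big(y_i+\log\frac{M}{\sqrt{(2\pi)^n}}\Big)\end{bmatrix}.$$ Let $\{\hat\mu_i^*,\hat\Sigma_i^*,y_i^*,\tau_i^*,\rho_i^*\}_{i=1}^M$ be an optimal solution of this program and set $\hat w_i^*=e^{y_i^*}\sqrt{|\hat\Sigma_i^*|}$. Then the function $\hat V^*(x)=\sum_{i=1}^M\hat w_i^*\,\phi(x,\hat\mu_i^*,\hat\Sigma_i^* )$ is a feasible solution of the problem $$\begin{aligned}\min_{\hat V_k\in\tilde{\mathcal F}}\quad&\int_{\mathcal{X}}\hat V_k(x)\,\nu(dx)\\ \text{subject to}\quad&\hat V_k(x)\ge\int_{\mathcal{X}}\hat V^*_{k+1}(z)\,Q(dz|x,u)\quad\forall(x,u)\in\bar{\mathcal{X}}\times\mathcal{U},\\ &\hat V_k(x)\ge1\quad\forall x\in K.\end{aligned}$$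
   Context: Gaussian RBF: $\phi(x,\mu,\Sigma)=\frac{1}{\sqrt{(2\pi)^n|\Sigma|}}\exp[-\tfrac12(x-\mu)^\top\Sigma^{-1}(x-\mu)]$ for $\mu\in\mathbb{R}^n$ and $\Sigma\in\mathbf S^n_+$, where $\mathbf S^n_+$ is the set of symmetric positive definite $n\times n$ matrices and $|\cdot|$ is the determinant. A Gaussian RBF sum is $\sum_{i=1}^M w_i\phi(\cdot,\mu_i,\Sigma_i)$ with $w_i\in\mathbb{R}$, $\mu_i\in\mathbb{R}^n$, $\Sigma_i\in\mathbf S^n_+$; $\tilde{\mathcal F}$ is the set of Gaussian RBF sums with $M$ elements (weights, means and covariances being parameters). A quadratic set in $\mathbb{R}^d$ is a set $\{x\in\mathbb{R}^d: [x;1]^\top A_j[x;1]\ge0,\ j=1,\dots,N\}$ for some $N\geq 1$ and symmetric $A_j\in\mathbb{R}^{(d+1)\times(d+1)}$, where $[x;1]$ is the column vector $x$ with an appended $1$. Thus $K_j\in\mathbb{R}^{(n+1)\times(n+1)}$ and $S_j\in\mathbb{R}^{(n+m+1)\times(n+m+1)}$ (acting on $[x;u;1]$). $\tilde K_j\in\mathbb{R}^{(n+m+1)\times(n+m+1)}$ is $K_j$ padded with zero rows and columns in the $u$-block, so that $[x;u;1]^\top\tilde K_j[x;u;1]=[x;1]^\top K_j[x;1]$. The matrices $Q_i,\bar Q_i,Q_{\mu_i,\bar\Sigma_i}$ have block rows and columns of sizes $n,m,1$; $Q_{\hat\mu_i}$ has block rows of sizes $1,m,n$ and block columns of sizes $n,m,1$;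 $Q_{\hat\Sigma_i}$ has block rows and columns of sizes $1,m,n$. $\mathbf0$, $I$ are zero and identity matrices of the appropriate dimensions, and $X\succcurlyeq0$ means symmetric positive semidefinite. The reach-avoid value functions are $V^*_T=\mathbf1_K$ and $V^*_k(x)=\sup_{u\in\mathcal{U}}\{\mathbf1_K(x)+\mathbf1_{\bar{\mathcal{X}}}(x)\int_{\mathcal{X}}V^*_{k+1}(y)Q(dy|x,u)\}$ for $k=T-1,\dots,0$. Standing assumption: $u\mapsto Q(A|x,u)$ is continuous for every $x\in\mathcal{X}$ and Borel $A\subseteq\mathcal{X}$. *)

theory Defs
  imports "HOL-Probability.Probability"
begin

subsection \<open>Block vectors and matrices\<close>

text \<open>
  Stacking of blocks is indexed by sum types: \<open>real^('a + 'b)\<close> is the space of vectors with an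
  \<open>'a\<close>-block followed by a \<open>'b\<close>-block, and the type \<open>unit\<close> indexes a block of size one.
  Three blocks are nested to the left.
\<close>

definition stack :: "real^'a \<Rightarrow> real^'b \<Rightarrow> real^('a + 'b)" where
  "stack x y = (\<chi> i. case i of Inl a \<Rightarrow> x $ a | Inr b \<Rightarrow> y $ b)"

definition homog :: "real^'d \<Rightarrow> real^('d + unit)" where
  "homog x = stack x 1"

definition block2 ::
  "real^'c1^'r1 \<Rightarrow> real^'c2^'r1 \<Rightarrow>
   real^'c1^'r2 \<Rightarrow> real^'c2^'r2 \<Rightarrow> real^('c1 + 'c2)^('r1 + 'r2)" where
  "block2 A B
          C D = (\<chi> i. case i of Inl r \<Rightarrow> stack (A $ r) (B $ r) | Inr r \<Rightarrow> stack (C $ r) (D $ r))"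

definition block3 ::
  "real^'c1^'r1 \<Rightarrow> real^'c2^'r1 \<Rightarrow> real^'c3^'r1 \<Rightarrow>
   real^'c1^'r2 \<Rightarrow> real^'c2^'r2 \<Rightarrow> real^'c3^'r2 \<Rightarrow>
   real^'c1^'r3 \<Rightarrow> real^'c2^'r3 \<Rightarrow> real^'c3^'r3 \<Rightarrow>
   real^(('c1 + 'c2) + 'c3)^(('r1 + 'r2) + 'r3)" where
  "block3 A B C
          D E F
          G H I =
     (\<chi> i. case i of
        Inl (Inl r) \<Rightarrow> stack (stack (A $ r) (B $ r)) (C $ r)
      | Inl (Inr r) \<Rightarrow> stack (stack (D $ r) (E $ r)) (F $ r)
      | Inr r \<Rightarrow> stack (stack (G $ r) (H $ r)) (I $ r))"

definition symmetric_matrix :: "real^'n^'n \<Rightarrow> bool" where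
  "symmetric_matrix A \<longleftrightarrow> transpose A = A"

definition psd :: "real^'n^'n \<Rightarrow> bool" where
  "psd A \<longleftrightarrow> symmetric_matrix A \<and> (\<forall>x. 0 \<le> x \<bullet> (A *v x))"

definition spd_matrices :: "(real^'n^'n) set" where
  "spd_matrices = {A. symmetric_matrix A \<and> (\<forall>x. x \<noteq> 0 \<longrightarrow> 0 < x \<bullet> (A *v x))}"

subsection \<open>Quadratic sets\<close>

definition quadratic_set :: "nat \<Rightarrow> (nat \<Rightarrow> real^('d + unit)^('d + unit)) \<Rightarrow> (real^'d) set" where
  "quadratic_set N A = {x. \<forall>j\<in>{1..N}. 0 \<le> homog x \<bullet> (A j *v homog x)}"

text \<open>\<open>A\<^sub>1, \<dots>, A\<^sub>N\<close> exhibit \<open>C\<close> as a quadratic set.\<close>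

definition describes_quadratic_set ::
  "nat \<Rightarrow> (nat \<Rightarrow> real^('d + unit)^('d + unit)) \<Rightarrow> (real^'d) set \<Rightarrow> bool" where
  "describes_quadratic_set N A C \<longleftrightarrow>
     1 \<le> N \<and> (\<forall>j\<in>{1..N}. symmetric_matrix (A j)) \<and> C = quadratic_set N A"

text \<open>The matrix \<open>K\<close>, acting on \<open>[x; 1]\<close>, padded with zero rows and columns in the \<open>u\<close>-block.\<close>

definition pad_u :: "real^('n::finite + unit)^('n + unit) \<Rightarrow> real^(('n + 'm::finite) + unit)^(('n + 'm) + unit)" where
  "pad_u K = block3 (\<chi> i j. K $ Inl i $ Inl j) 0 (\<chi> i j. K $ Inl i $ Inr j)
                    0                          0 0
                    (\<chi> i j. K $ Inr i $ Inl j) 0 (\<chi> i j. K $ Inr i $ Inr j)"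

lemma sum_UNIV_Plus:
  "(\<Sum>i\<in>(UNIV :: ('a::finite + 'b::finite) set). f i) = (\<Sum>a\<in>UNIV. f (Inl a)) + (\<Sum>b\<in>UNIV. f (Inr b))"
  using sum.Plus[of "UNIV :: 'a set" "UNIV :: 'b set" f] by (simp add: UNIV_Plus_UNIV comp_def)

lemma quadratic_form_pad_u:
  "homog (stack x u) \<bullet> (pad_u K *v homog (stack x u)) = homog x \<bullet> (K *v homog x)"
  by (simp add: homog_def stack_def pad_u_def block3_def inner_vec_def matrix_vector_mult_def
      sum_UNIV_Plus)

subsection \<open>Gaussian radial basis functions\<close>

definition gauss_rbf :: "real^'n \<Rightarrow> real^'n \<Rightarrow> real^'n^'n \<Rightarrow> real" where
  "gauss_rbf x \<mu> \<Sigma> =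
     1 / sqrt ((2 * pi) ^ CARD('n) * det \<Sigma>) *
     exp (- (1 / 2) * ((x - \<mu>) \<bullet> (matrix_inv \<Sigma> *v (x - \<mu>))))"

definition rbf_sum ::
  "nat \<Rightarrow> (nat \<Rightarrow> real) \<Rightarrow> (nat \<Rightarrow> real^'n) \<Rightarrow> (nat \<Rightarrow> real^'n^'n) \<Rightarrow> real^'n \<Rightarrow> real" where
  "rbf_sum M w \<mu> \<Sigma> x = (\<Sum>i=1..M. w i * gauss_rbf x (\<mu> i) (\<Sigma> i))"

definition rbf_sums :: "nat \<Rightarrow> (real^'n \<Rightarrow> real) set" where
  "rbf_sums M = {rbf_sum M w \<mu> \<Sigma> | w \<mu> \<Sigma>. \<forall>i\<in>{1..M}. \<Sigma> i \<in> spd_matrices}"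

subsection \<open>Stochastic kernels and reach-avoid value functions\<close>

definition stochastic_kernel ::
  "(real^'m) set \<Rightarrow> (real^'n \<Rightarrow> real^'m \<Rightarrow> (real^'n) measure) \<Rightarrow> bool" where
  "stochastic_kernel U Q \<longleftrightarrow>
     (\<lambda>(x, u). Q x u) \<in> borel \<Otimes>\<^sub>M restrict_space borel U \<rightarrow>\<^sub>M prob_algebra borel"

text \<open>\<open>value_to_go U K Xbar Q j\<close> is the value function with \<open>j\<close> steps remaining, \<open>V\<^sup>*\<^sub>k\<close> for
  \<open>k = T - j\<close>. All values lie in \<open>[0, 1]\<close> when \<open>U\<close> is nonempty and \<open>K\<close>, \<open>Xbar\<close> are disjoint,
  so the supremum of reals is then a genuine one.\<close>

primrec value_to_go ::
  "(real^'m) set \<Rightarrow> (real^'n) set \<Rightarrow> (real^'n) set \<Rightarrow>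
   (real^'n \<Rightarrow> real^'m \<Rightarrow> (real^'n) measure) \<Rightarrow> nat \<Rightarrow> real^'n \<Rightarrow> real" where
  "value_to_go U K Xbar Q 0 = indicator K"
| "value_to_go U K Xbar Q (Suc j) =
     (\<lambda>x. SUP u\<in>U. indicator K x + indicator Xbar x * (\<integral>y. value_to_go U K Xbar Q j y \<partial>Q x u))"

definition reach_avoid_value ::
  "(real^'m) set \<Rightarrow> (real^'n) set \<Rightarrow> (real^'n) set \<Rightarrow>
   (real^'n \<Rightarrow> real^'m \<Rightarrow> (real^'n) measure) \<Rightarrow> nat \<Rightarrow> nat \<Rightarrow> real^'n \<Rightarrow> real" where
  "reach_avoid_value U K Xbar Q T k = value_to_go U K Xbar Q (T - k)"

subsection \<open>Minimisation problems\<close>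

text \<open>A minimisation problem is given by its objective and its feasible set.\<close>

type_synonym 'a min_problem = "('a \<Rightarrow> real) \<times> 'a set"

definition feasible_solution :: "'a min_problem \<Rightarrow> 'a \<Rightarrow> bool" where
  "feasible_solution P v \<longleftrightarrow> v \<in> snd P"

definition optimal_solution :: "'a min_problem \<Rightarrow> 'a \<Rightarrow> bool" where
  "optimal_solution P v \<longleftrightarrow> feasible_solution P v \<and> (\<forall>v'. feasible_solution P v' \<longrightarrow> fst P v \<le> fst P v')"

definition reach_avoid_problem ::
  "nat \<Rightarrow> (real^'n) measure \<Rightarrow> (real^'n) set \<Rightarrow> (real^'n) set \<Rightarrow> (real^'m) set \<Rightarrow>
   (real^'n \<Rightarrow> real^'m \<Rightarrow> (real^'n) measure) \<Rightarrow> (real^'n \<Rightarrow> real) \<Rightarrow> (real^'n \<Rightarrow> real) min_problem" where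
  "reach_avoid_problem M \<nu> K Xbar U Q Vnext =
     (\<lambda>V. \<integral>x. V x \<partial>\<nu>,
      {V \<in> rbf_sums M.
         (\<forall>x\<in>Xbar. \<forall>u\<in>U. (\<integral>z. Vnext z \<partial>Q x u) \<le> V x) \<and>
         (\<forall>x\<in>K. 1 \<le> V x)})"

subsection \<open>The semidefinite program\<close>

definition scalar_block :: "real \<Rightarrow> real^unit^unit" where
  "scalar_block c = mat c"

definition Q_mat :: "real^'n^'n \<Rightarrow> real \<Rightarrow> real^'n^'n \<Rightarrow> real \<Rightarrow>
    real^(('n + 'm::finite) + unit)^(('n + 'm) + unit)" where
  "Q_mat \<Sigma>0 w \<Sigma> y =
     block3 0 0 0
            0 0 0
            0 0 (scalar_block (2 * (y + ln (sqrt (det (\<Sigma> + \<Sigma>0)) / w))))"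

definition Qbar_mat :: "nat \<Rightarrow> real \<Rightarrow> real^(('n::finite + 'm::finite) + unit)^(('n + 'm) + unit)" where
  "Qbar_mat M y =
     block3 0 0 0
            0 0 0
            0 0 (scalar_block (2 * (y + ln (real M / sqrt ((2 * pi) ^ CARD('n))))))"

definition Q_muhat :: "real^'n \<Rightarrow> real^(('n + 'm::finite) + unit)^((unit + 'm) + 'n)" where
  "Q_muhat \<mu>h =
     block3 0       0 0
            0       0 0
            (mat 1) 0 (- columnvector \<mu>h)"

definition Q_Sigmahat :: "real^'n^'n \<Rightarrow> real^((unit + 'm::finite) + 'n)^((unit + 'm) + 'n)" where
  "Q_Sigmahat \<Sigma>h =
     block3 (mat 1) 0       0
            0       (mat 1) 0
            0       0       (matrix_inv \<Sigma>h)"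

definition Q_mu_Sigmabar :: "real^'n^'n \<Rightarrow> real^'m^'n \<Rightarrow> real^'n \<Rightarrow> real^'n^'n \<Rightarrow>
    real^(('n + 'm) + unit)^(('n + 'm) + unit)" where
  "Q_mu_Sigmabar A B \<mu> \<Sigma>b =
     block3 (transpose A ** \<Sigma>b ** A) (transpose A ** \<Sigma>b ** B) (- (transpose A ** \<Sigma>b ** columnvector \<mu>))
            (transpose B ** \<Sigma>b ** A) (transpose B ** \<Sigma>b ** B) (- (transpose B ** \<Sigma>b ** columnvector \<mu>))
            (- (rowvector \<mu> ** \<Sigma>b ** A)) (- (rowvector \<mu> ** \<Sigma>b ** B)) (rowvector \<mu> ** \<Sigma>b ** columnvector \<mu>)"

definition X_mat ::
  "real^'n^'n \<Rightarrow> real^'m^'n \<Rightarrow> real^'n^'n \<Rightarrow> nat \<Rightarrow>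
   (nat \<Rightarrow> real^(('n + 'm) + unit)^(('n + 'm) + unit)) \<Rightarrow> real \<Rightarrow> real^'n \<Rightarrow> real^'n^'n \<Rightarrow>
   real^'n \<Rightarrow> real^'n^'n \<Rightarrow> real \<Rightarrow> (nat \<Rightarrow> real) \<Rightarrow>
   real^(((unit + 'm) + 'n) + (('n + 'm) + unit))^(((unit + 'm) + 'n) + (('n + 'm) + unit))" where
  "X_mat A B \<Sigma>0 N Sm w \<mu> \<Sigma> \<mu>h \<Sigma>h y \<tau> =
     block2 (matrix_inv (Q_Sigmahat \<Sigma>h)) (Q_muhat \<mu>h)
            (transpose (Q_muhat \<mu>h))
            (Q_mat \<Sigma>0 w \<Sigma> y + Q_mu_Sigmabar A B \<mu> (matrix_inv (\<Sigma> + \<Sigma>0)) - (\<Sum>j=1..N. \<tau> j *\<^sub>R Sm j))"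

definition Xbar_mat ::
  "nat \<Rightarrow> nat \<Rightarrow> (nat \<Rightarrow> real^('n + unit)^('n + unit)) \<Rightarrow>
   real^'n \<Rightarrow> real^'n^'n \<Rightarrow> real \<Rightarrow> (nat \<Rightarrow> real) \<Rightarrow>
   real^(((unit + 'm::finite) + 'n) + (('n + 'm) + unit))^(((unit + 'm) + 'n) + (('n + 'm) + unit))" where
  "Xbar_mat M N Km \<mu>h \<Sigma>h y \<rho> =
     block2 (matrix_inv (Q_Sigmahat \<Sigma>h)) (Q_muhat \<mu>h)
            (transpose (Q_muhat \<mu>h))
            (Qbar_mat M y - (\<Sum>j=1..N. \<rho> j *\<^sub>R pad_u (Km j)))"

text \<open>Decision variables \<open>(\<mu>h, \<Sigma>h, y, \<tau>, \<rho>)\<close>; only their entries with index \<open>i \<in> {1..M}\<close> and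
  \<open>j \<in> {1..N}\<close> are constrained or used.\<close>

type_synonym 'n sdp_vars =
  "(nat \<Rightarrow> real^'n) \<times> (nat \<Rightarrow> real^'n^'n) \<times> (nat \<Rightarrow> real) \<times> (nat \<Rightarrow> nat \<Rightarrow> real) \<times> (nat \<Rightarrow> nat \<Rightarrow> real)"

definition sdp_problem ::
  "real^'n^'n \<Rightarrow> real^'m^'n \<Rightarrow> real^'n^'n \<Rightarrow> nat \<Rightarrow>
   (nat \<Rightarrow> real^('n + unit)^('n + unit)) \<Rightarrow> (nat \<Rightarrow> real^(('n + 'm) + unit)^(('n + 'm) + unit)) \<Rightarrow>
   nat \<Rightarrow> (nat \<Rightarrow> real) \<Rightarrow> (nat \<Rightarrow> real^'n) \<Rightarrow> (nat \<Rightarrow> real^'n^'n) \<Rightarrow> 'n sdp_vars min_problem" where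
  "sdp_problem A B \<Sigma>0 N Km Sm M w \<mu> \<Sigma> =
     (\<lambda>(\<mu>h, \<Sigma>h, y, \<tau>, \<rho>). \<Sum>i=1..M. y i + 1 / 2 * trace (\<Sigma>h i),
      {(\<mu>h, \<Sigma>h, y, \<tau>, \<rho>). \<forall>i\<in>{1..M}.
         psd (X_mat A B \<Sigma>0 N Sm (w i) (\<mu> i) (\<Sigma> i) (\<mu>h i) (\<Sigma>h i) (y i) (\<tau> i)) \<and>
         psd (Xbar_mat M N Km (\<mu>h i) (\<Sigma>h i) (y i) (\<rho> i)
               :: real^(((unit + 'm) + 'n) + (('n + 'm) + unit))^(((unit + 'm) + 'n) + (('n + 'm) + unit))) \<and>
         (\<forall>j\<in>{1..N}. 0 \<le> \<tau> i j \<and> 0 \<le> \<rho> i j) \<and>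
         \<Sigma>h i \<in> spd_matrices})"

end

theory Submission
  imports Defs
begin

text \<open>
  The proof compares Gaussians one index \<open>i\<close> at a time; \<open>wh\<^sub>i = exp y\<^sub>i sqrt |\<Sigma>h\<^sub>i|\<close> denotes the weights of
  the candidate.

  Integrating a product of two Gaussian densities merges them: the factor \<open>\<phi>(\<cdot>, \<mu>\<^sub>i, \<Sigma>\<^sub>i)\<close> of the next
  value function, averaged over the kernel with mean \<open>m = A x + B u\<close> and covariance \<open>\<Sigma>\<^sub>0\<close>, becomes
  \<open>\<phi>(m, \<mu>\<^sub>i, \<Sigma>\<^sub>i + \<Sigma>\<^sub>0)\<close> (\<open>has_bochner_integral_gauss_rbf_product\<close>). Thus the first constraint of the
  reach-avoid problem holds as soon as
  \<open>w\<^sub>i \<phi>(m, \<mu>\<^sub>i, \<Sigma>\<^sub>i + \<Sigma>\<^sub>0) \<le> wh\<^sub>i \<phi>(x, \<mu>h\<^sub>i, \<Sigma>h\<^sub>i)\<close> for each \<open>i\<close>, and the second as soon as each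
  \<open>wh\<^sub>i \<phi>(x, \<mu>h\<^sub>i, \<Sigma>h\<^sub>i)\<close> is at least \<open>1 / M\<close> on \<open>K\<close>. After taking logarithms
  (\<open>weighted_gauss_rbf_eq_exp\<close>) both are inequalities between quadratic polynomials in \<open>(x, u)\<close>: the
  normalising constant \<open>(2 \<pi>)\<^sup>n\<close> cancels in the first, and the choice of
  \<open>wh\<^sub>i\<close> removes the determinant of \<open>\<Sigma>h\<^sub>i\<close> from both.

  These polynomial inequalities are what the two matrix inequalities encode. A positive semidefinite
  block matrix dominates its Schur complement (\<open>psd_block2_schur\<close>), which puts the Mahalanobis term
  \<open>(x - \<mu>h\<^sub>i)\<^sup>T \<Sigma>h\<^sub>i\<^sup>-\<^sup>1 (x - \<mu>h\<^sub>i)\<close> below the quadratic form of the lower right corner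
  (\<open>mahalanobis_le_corner\<close>). The multipliers \<open>\<tau>\<close> and \<open>\<rho>\<close> are nonnegative and the forms that
  describe the two quadratic sets are nonnegative on these sets, so the subtracted sums can be dropped
  there (the easy half of the S-procedure).

  Most of the work is the merging formula. Completing the square turns the product of two Gaussians
  into a constant times a third Gaussian (\<open>gauss_rbf_product\<close>), so the formula rests on the
  normalisation \<open>has_bochner_integral_gauss_rbf\<close>. A basis that is orthonormal for \<open>\<Sigma>\<close>
  (\<open>spd_congruent_to_identity\<close>) provides a linear substitution that makes the integrand a product of
  one-dimensional Gaussians; the substitution formula over an arbitrary finite index type is
  \<open>nn_integral_lborel_linear\<close>.
\<close>

section \<open>Linear substitutions in Lebesgue integrals\<close>

text \<open>
  By Fubini the integral can be sliced along lines in direction \<open>i\<close>. On such a line the coordinate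
  \<open>x \<bullet> j\<close> is constant, so the shear is a translation of the line and leaves its integral unchanged.
\<close>

lemma nn_integral_lborel_shear:
  fixes f :: "'a::euclidean_space \<Rightarrow> ennreal"
  assumes i: "i \<in> Basis" and j: "j \<in> Basis" and "i \<noteq> j" and [measurable]: "f \<in> borel_measurable borel"
  shows "(\<integral>\<^sup>+x. f (x + (x \<bullet> j) *\<^sub>R i) \<partial>lborel) = (\<integral>\<^sup>+x. f x \<partial>lborel)"
proof -
  interpret product_sigma_finite "\<lambda>_. lborel :: real measure" ..
  let ?J = "Basis - {i}"
  define c where "c \<omega> = (\<Sum>b\<in>?J. \<omega> b *\<^sub>R b)" for \<omega> :: "'a \<Rightarrow> real"
  have slice: "(\<integral>\<^sup>+x. g x \<partial>lborel) = (\<integral>\<^sup>+\<omega>. (\<integral>\<^sup>+t. g (t *\<^sub>R i + c \<omega>) \<partial>lborel) \<partial>(\<Pi>\<^sub>M b\<in>?J. lborel))"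
    if [measurable]: "g \<in> borel_measurable borel" for g :: "'a \<Rightarrow> ennreal"
  proof -
    have B: "insert i ?J = Basis" using i by auto
    have "(\<integral>\<^sup>+x. g x \<partial>lborel) = (\<integral>\<^sup>+\<omega>. g (\<Sum>b\<in>Basis. \<omega> b *\<^sub>R b) \<partial>(\<Pi>\<^sub>M b\<in>insert i ?J. lborel))"
      by (subst lborel_eq, subst B) (simp add: nn_integral_distr)
    also have "\<dots> = (\<integral>\<^sup>+\<omega>. (\<integral>\<^sup>+t. g (\<Sum>b\<in>Basis. (if b = i then t else \<omega> b) *\<^sub>R b) \<partial>lborel) \<partial>(\<Pi>\<^sub>M b\<in>?J. lborel))"
      by (subst product_nn_integral_insert) (auto simp: fun_upd_def cong: if_cong)
    also have "(\<lambda>\<omega> t. \<Sum>b\<in>Basis. (if b = i then t else \<omega> b) *\<^sub>R b) = (\<lambda>\<omega> t. t *\<^sub>R i + c \<omega>)"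
      using i by (simp add: fun_eq_iff c_def sum.remove[of Basis i])
    finally show ?thesis .
  qed
  have cj: "c \<omega> \<bullet> j = \<omega> j" for \<omega>
    using i j \<open>i \<noteq> j\<close>
    by (simp add: c_def inner_sum_left inner_Basis if_distrib[of "\<lambda>x. _ * x"] sum.If_cases cong: if_cong)
  have "(\<integral>\<^sup>+x. f (x + (x \<bullet> j) *\<^sub>R i) \<partial>lborel) =
      (\<integral>\<^sup>+\<omega>. (\<integral>\<^sup>+t. f ((\<omega> j + 1 * t) *\<^sub>R i + c \<omega>) \<partial>lborel) \<partial>(\<Pi>\<^sub>M b\<in>?J. lborel))"
    using i j \<open>i \<noteq> j\<close>
    by (subst slice) (simp_all add: inner_add_left cj inner_Basis scaleR_add_left algebra_simps)
  also have "\<dots> = (\<integral>\<^sup>+\<omega>. (\<integral>\<^sup>+t. f (t *\<^sub>R i + c \<omega>) \<partial>lborel) \<partial>(\<Pi>\<^sub>M b\<in>?J. lborel))"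
  proof (rule nn_integral_cong)
    fix \<omega>
    show "(\<integral>\<^sup>+t. f ((\<omega> j + 1 * t) *\<^sub>R i + c \<omega>) \<partial>lborel) = (\<integral>\<^sup>+t. f (t *\<^sub>R i + c \<omega>) \<partial>lborel)"
      using nn_integral_real_affine[of "\<lambda>t. f (t *\<^sub>R i + c \<omega>)" 1 "\<omega> j"] by simp
  qed
  also have "\<dots> = (\<integral>\<^sup>+x. f x \<partial>lborel)"
    by (rule slice[symmetric]) simp
  finally show ?thesis .
qed

text \<open>
  Lebesgue measure is determined by its values on boxes, and exchanging two coordinates maps a box to
  a box with the same side lengths.
\<close>

lemma lborel_distr_transpose_coordinates:
  fixes m n :: "'n::finite"
  shows "distr lborel borel (\<lambda>x::real^'n. \<chi> i. x $ Transposition.transpose m n i) = lborel"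
proof -
  let ?h = "\<lambda>x::real^'n. \<chi> i. x $ Transposition.transpose m n i"
  have [measurable]: "?h \<in> borel_measurable borel"
    by (intro borel_measurable_continuous_onI continuous_intros)
  have hh: "?h (?h x) = x" for x by (simp add: vec_eq_iff)
  have inner_h: "?h x \<bullet> b = x \<bullet> ?h b" for x b
    unfolding inner_vec_def
    by (rule sum.reindex_bij_witness[where i="Transposition.transpose m n" and j="Transposition.transpose m n"]) simp_all
  have hB: "?h b \<in> Basis" if b: "b \<in> Basis" for b
  proof -
    obtain i where "b = axis i 1" using b by (auto simp: Basis_vec_def)
    then have "?h b = axis (Transposition.transpose m n i) 1"
      by (auto simp: vec_eq_iff axis_def)
    then show ?thesis by (simp add: axis_in_Basis_iff)
  qed
  have swap: "(\<forall>b\<in>Basis. R b (?h b)) \<longleftrightarrow> (\<forall>b\<in>Basis. R (?h b) b)" for R :: "real^'n \<Rightarrow> real^'n \<Rightarrow> bool"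
    by (metis hh hB)
  have "lborel = distr lborel borel ?h"
  proof (rule lborel_eqI)
    fix l u :: "real^'n" assume le: "\<And>b. b \<in> Basis \<Longrightarrow> l \<bullet> b \<le> u \<bullet> b"
    have "?h -` box l u = box (?h l) (?h u)"
      using swap[of "\<lambda>b b'. l \<bullet> b < x \<bullet> b' \<and> x \<bullet> b' < u \<bullet> b" for x]
      by (auto simp: box_def inner_h)
    then have "emeasure (distr lborel borel ?h) (box l u) = emeasure lborel (box (?h l) (?h u))"
      by (simp add: emeasure_distr)
    also have "\<dots> = (\<Prod>b\<in>Basis. (?h u - ?h l) \<bullet> b)"
      using le hB by (subst emeasure_lborel_box) (auto simp: inner_h)
    also have "(\<Prod>b\<in>Basis. (?h u - ?h l) \<bullet> b) = (\<Prod>b\<in>Basis. (u - l) \<bullet> b)"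
      by (rule prod.reindex_bij_witness[where i="?h" and j="?h"])
        (auto simp: hB hh inner_h inner_diff_left)
    finally show "emeasure (distr lborel borel ?h) (box l u) = (\<Prod>b\<in>Basis. (u - l) \<bullet> b)" .
  qed simp
  then show ?thesis by simp
qed

text \<open>
  Every linear map is a composition of coordinate stretches, transpositions, shears, and maps with a
  vanishing coordinate. The formula passes to compositions because determinants multiply; it holds for
  stretches because boxes scale by the product of the factors, for transpositions and shears because
  these preserve Lebesgue measure and have determinant \<open>-1\<close> or \<open>1\<close>, and maps of the last kind are
  singular.
\<close>

theorem nn_integral_lborel_linear:
  fixes g :: "real^'n \<Rightarrow> real^'n" and f :: "real^'n \<Rightarrow> ennreal"
  assumes "linear g" and "det (matrix g) \<noteq> 0" and "f \<in> borel_measurable borel"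
  shows "(\<integral>\<^sup>+x. f x \<partial>lborel) = ennreal \<bar>det (matrix g)\<bar> * (\<integral>\<^sup>+x. f (g x) \<partial>lborel)"
proof -
  define P where "P g \<longleftrightarrow> (det (matrix g) \<noteq> 0 \<longrightarrow>
    (\<forall>f\<in>borel_measurable borel. (\<integral>\<^sup>+x. f x \<partial>lborel) = ennreal \<bar>det (matrix g)\<bar> * (\<integral>\<^sup>+x. f (g x) \<partial>lborel)))"
    for g :: "real^'n \<Rightarrow> real^'n"
  have "P g"
  proof (rule induct_linear_elementary[OF \<open>linear g\<close>])
    fix g1 g2 :: "real^'n \<Rightarrow> real^'n"
    assume lin: "linear g1" "linear g2" and P: "P g1" "P g2"
    have [measurable]: "g1 \<in> borel_measurable borel"
      using lin(1) by (simp add: borel_measurable_continuous_onI linear_continuous_on linear_conv_bounded_linear)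
    show "P (g1 \<circ> g2)"
      unfolding P_def matrix_compose[OF lin(2,1)] det_mul
    proof (intro impI ballI)
      fix f :: "real^'n \<Rightarrow> ennreal"
      assume det: "det (matrix g1) * det (matrix g2) \<noteq> 0" and [measurable]: "f \<in> borel_measurable borel"
      have "(\<integral>\<^sup>+x. f x \<partial>lborel) = ennreal \<bar>det (matrix g1)\<bar> * (\<integral>\<^sup>+x. f (g1 x) \<partial>lborel)"
        using P(1)[unfolded P_def, rule_format, of f] det by simp
      also have "(\<integral>\<^sup>+x. f (g1 x) \<partial>lborel) = ennreal \<bar>det (matrix g2)\<bar> * (\<integral>\<^sup>+x. f (g1 (g2 x)) \<partial>lborel)"
        using P(2)[unfolded P_def, rule_format, of "\<lambda>x. f (g1 x)"] det by simp
      finally show "(\<integral>\<^sup>+x. f x \<partial>lborel) =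
          ennreal \<bar>det (matrix g1) * det (matrix g2)\<bar> * (\<integral>\<^sup>+x. f ((g1 \<circ> g2) x) \<partial>lborel)"
        by (simp add: abs_mult ennreal_mult mult.assoc)
    qed
  next
    fix h :: "real^'n \<Rightarrow> real^'n" and i
    assume h: "linear h" "\<And>x. h x $ i = 0"
    have "\<not> surj h"
      using h(2) by (metis surjE vec_component zero_neq_one)
    then have "det (matrix h) = 0"
      using det_nz_iff_inj[OF h(1)] linear_injective_imp_surjective[OF h(1)] by blast
    then show "P h" by (simp add: P_def)
  next
    fix c :: "'n \<Rightarrow> real"
    let ?h = "\<lambda>x::real^'n. \<chi> i. c i * x $ i"
    have det: "det (matrix ?h) = prod c UNIV"
      by (simp add: axis_def matrix_def det_diagonal)
    define d where "d b = c (THE i. b = axis i 1)" for b :: "real^'n"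
    have d: "d (axis i 1) = c i" for i by (simp add: d_def axis_eq_axis)
    have B: "(Basis :: (real^'n) set) = range (\<lambda>i. axis i 1)" by (auto simp: Basis_vec_def)
    have inj: "inj (\<lambda>i. axis i (1::real) :: real^'n)" by (auto simp: inj_on_def axis_eq_axis)
    have h: "?h = (\<lambda>x. 0 + (\<Sum>b\<in>Basis. (d b * (x \<bullet> b)) *\<^sub>R b))"
    proof (intro ext, subst vec_eq_iff, intro allI)
      fix x :: "real^'n" and i
      have "(\<Sum>b\<in>Basis. (d b * (x \<bullet> b)) *\<^sub>R b) $ i = (\<Sum>j\<in>UNIV. c j * x $ j * axis j 1 $ i)"
        by (simp add: B sum.reindex[OF inj] d inner_axis)
      also have "\<dots> = (\<Sum>j\<in>UNIV. if j = i then c i * x $ i else 0)"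
        by (rule sum.cong) (auto simp: axis_def)
      finally show "?h x $ i = (0 + (\<Sum>b\<in>Basis. (d b * (x \<bullet> b)) *\<^sub>R b)) $ i" by simp
    qed
    have [measurable]: "?h \<in> borel_measurable borel"
      by (intro borel_measurable_continuous_onI continuous_intros)
    show "P ?h"
      unfolding P_def det
    proof (intro impI ballI)
      fix f :: "real^'n \<Rightarrow> ennreal"
      assume nz: "prod c UNIV \<noteq> 0" and [measurable]: "f \<in> borel_measurable borel"
      have "lborel = density (distr lborel borel ?h) (\<lambda>_. ennreal (\<Prod>b\<in>Basis. \<bar>d b\<bar>))"
        unfolding h by (rule lborel_affine_euclidean) (use nz in \<open>auto simp: B d\<close>)
      also have "(\<Prod>b\<in>Basis. \<bar>d b\<bar>) = \<bar>prod c UNIV\<bar>"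
        by (simp add: B prod.reindex[OF inj] d abs_prod)
      finally have "(\<integral>\<^sup>+x. f x \<partial>lborel) = (\<integral>\<^sup>+x. f x \<partial>density (distr lborel borel ?h) (\<lambda>_. ennreal \<bar>prod c UNIV\<bar>))"
        by simp
      also have "\<dots> = ennreal \<bar>prod c UNIV\<bar> * (\<integral>\<^sup>+x. f (?h x) \<partial>lborel)"
        by (simp add: nn_integral_density nn_integral_distr nn_integral_cmult)
      finally show "(\<integral>\<^sup>+x. f x \<partial>lborel) = ennreal \<bar>prod c UNIV\<bar> * (\<integral>\<^sup>+x. f (?h x) \<partial>lborel)" .
    qed
  next
    fix m n :: 'n
    let ?h = "\<lambda>x::real^'n. \<chi> i. x $ Transposition.transpose m n i"
    have [measurable]: "?h \<in> borel_measurable borel"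
      by (intro borel_measurable_continuous_onI continuous_intros)
    have "matrix ?h = (\<chi> i. mat 1 $ Transposition.transpose m n i)"
      by (simp add: matrix_def mat_def axis_def vec_eq_iff)
    then have det: "\<bar>det (matrix ?h)\<bar> = 1"
      by (simp add: det_permute_rows permutes_swap_id sign_swap_id abs_mult)
    have int: "(\<integral>\<^sup>+x. f x \<partial>lborel) = (\<integral>\<^sup>+x. f (?h x) \<partial>lborel)"
      if [measurable]: "f \<in> borel_measurable borel" for f :: "real^'n \<Rightarrow> ennreal"
      using nn_integral_distr[of ?h lborel borel f] by (simp add: lborel_distr_transpose_coordinates)
    show "P ?h"
      unfolding P_def det by (intro impI ballI, subst int) simp_all
  next
    fix m n :: 'n assume mn: "m \<noteq> n"
    let ?h = "\<lambda>x::real^'n. \<chi> i. if i = m then x $ m + x $ n else x $ i"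
    have "matrix ?h = (\<chi> k. if k = m then row m (mat 1) + 1 *s row n (mat 1) else row k (mat 1))"
      using mn by (simp add: matrix_def mat_def axis_def vec_eq_iff row_def)
    then have det: "det (matrix ?h) = 1"
      using det_row_operation[OF mn, of "mat 1 :: real^'n^'n" 1] by simp
    have h: "x + (x \<bullet> axis n 1) *\<^sub>R axis m 1 = ?h x" for x
      by (simp add: vec_eq_iff inner_axis) (simp add: axis_def)
    have "(\<integral>\<^sup>+x. f (?h x) \<partial>lborel) = (\<integral>\<^sup>+x. f x \<partial>lborel)"
      if "f \<in> borel_measurable borel" for f :: "real^'n \<Rightarrow> ennreal"
      using nn_integral_lborel_shear[of "axis m 1" "axis n 1" f, unfolded h] mn that
      by (simp add: axis_in_Basis_iff axis_eq_axis)
    then show "P ?h"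
      unfolding P_def det by simp
  qed
  then show ?thesis using assms unfolding P_def by blast
qed

section \<open>Symmetric positive definite matrices\<close>

text \<open>
  Products with a transposed matrix stay in the form \<open>transpose A *v x\<close>, to which the adjoint rule
  below and the associativity of matrix products apply.
\<close>

declare transpose_matrix_vector [simp del]

lemma inner_matrix_vector_mult_left:
  fixes A :: "real^'c^'r"
  shows "(A *v x) \<bullet> y = x \<bullet> (transpose A *v y)"
  by (metis dot_lmul_matrix inner_commute vector_transpose_matrix)

lemma matrix_add_rdistrib:
  fixes A B :: "real^'b^'a" and C :: "real^'c^'b"
  shows "(A + B) ** C = A ** C + B ** C"
  by (simp add: matrix_matrix_mult_def vec_eq_iff sum.distrib distrib_right)

lemma matrix_vector_mult_minus:
  fixes A :: "real^'b^'a"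
  shows "A *v (- x) = - (A *v x)" and "(- A) *v x = - (A *v x)"
  by (simp_all add: matrix_vector_mult_def vec_eq_iff sum_negf)

lemma spdD:
  assumes "A \<in> spd_matrices"
  shows "transpose A = A" and "x \<noteq> 0 \<Longrightarrow> 0 < x \<bullet> (A *v x)"
  using assms by (auto simp: spd_matrices_def symmetric_matrix_def)

lemma spd_invertible:
  assumes "A \<in> spd_matrices"
  shows "invertible A"
proof -
  have "x = 0" if "A *v x = 0" for x
    using spdD(2)[OF assms, of x] that by (cases "x = 0") auto
  then show ?thesis
    by (simp add: invertible_left_inverse matrix_left_invertible_ker)
qed

lemma matrix_inv_mult:
  fixes A :: "real^'n^'n"
  assumes "invertible A"
  shows "A ** matrix_inv A = mat 1" and "matrix_inv A ** A = mat 1"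
proof -
  have "\<exists>A'. A ** A' = mat 1 \<and> A' ** A = mat 1" using assms by (simp add: invertible_def)
  from someI_ex[OF this] show "A ** matrix_inv A = mat 1" "matrix_inv A ** A = mat 1"
    by (simp_all add: matrix_inv_def)
qed

lemma matrix_inv_eqI:
  fixes A B :: "real^'n^'n"
  assumes "A ** B = mat 1"
  shows "matrix_inv A = B"
proof -
  have "invertible A" using assms invertible_right_inverse by blast
  then have "matrix_inv A = matrix_inv A ** (A ** B)" by (simp add: assms)
  also have "\<dots> = B" using matrix_inv_mult(2)[OF \<open>invertible A\<close>] by (simp add: matrix_mul_assoc)
  finally show ?thesis .
qed

lemma spd_add:
  assumes "A \<in> spd_matrices" and "B \<in> spd_matrices"
  shows "A + B \<in> spd_matrices"
proof -
  have "transpose (A + B) = A + B"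
    using spdD(1)[OF assms(1)] spdD(1)[OF assms(2)] by (simp add: transpose_def vec_eq_iff)
  then show ?thesis
    using assms by (auto simp: spd_matrices_def symmetric_matrix_def matrix_vector_mult_add_rdistrib
        inner_add_right add_pos_pos)
qed

lemma spd_matrix_inv:
  fixes A :: "real^'n^'n"
  assumes "A \<in> spd_matrices"
  shows "matrix_inv A \<in> spd_matrices"
proof -
  note inv = matrix_inv_mult[OF spd_invertible[OF assms]]
  have "transpose (matrix_inv A) = matrix_inv A"
  proof (rule matrix_inv_eqI[symmetric])
    have "A ** transpose (matrix_inv A) = transpose (matrix_inv A ** A)"
      by (simp add: matrix_transpose_mul spdD(1)[OF assms])
    then show "A ** transpose (matrix_inv A) = mat 1" by (simp add: inv transpose_mat)
  qed
  moreover have "0 < x \<bullet> (matrix_inv A *v x)" if "x \<noteq> 0" for x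
  proof -
    let ?y = "matrix_inv A *v x"
    have x: "A *v ?y = x" by (simp add: matrix_vector_mul_assoc inv)
    with that have "?y \<noteq> 0" by (metis matrix_vector_mult_0_right)
    from spdD(2)[OF assms this] show ?thesis unfolding x by (simp add: inner_commute)
  qed
  ultimately show ?thesis by (simp add: spd_matrices_def symmetric_matrix_def)
qed

lemma matrix_inv_matrix_inv:
  fixes A :: "real^'n^'n"
  assumes "invertible A"
  shows "matrix_inv (matrix_inv A) = A"
  by (rule matrix_inv_eqI) (rule matrix_inv_mult(2)[OF assms])

text \<open>
  Gram-Schmidt for the inner product \<open>x \<bullet> (P *v y)\<close>; the columns of \<open>F\<close> are an orthonormal basis. While
  fewer than \<open>n\<close> orthonormal vectors \<open>f j\<close> have been found, the vectors \<open>P *v f j\<close> span a proper subspace,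
  and a nonzero vector that is orthogonal to it in the ordinary sense can be normalised and added.
\<close>

lemma spd_congruent_to_identity:
  fixes P :: "real^'n^'n"
  assumes "P \<in> spd_matrices"
  obtains F :: "real^'n^'n" where "transpose F ** P ** F = mat 1"
proof -
  have ex: "\<exists>f :: nat \<Rightarrow> real^'n. \<forall>i<k. \<forall>j<k. f i \<bullet> (P *v f j) = (if i = j then 1 else 0)"
    if "k \<le> CARD('n)" for k
    using that
  proof (induction k)
    case (Suc k)
    then obtain f :: "nat \<Rightarrow> real^'n"
      where f: "\<And>i j. i < k \<Longrightarrow> j < k \<Longrightarrow> f i \<bullet> (P *v f j) = (if i = j then 1 else 0)"
      by auto
    let ?S = "(\<lambda>j. P *v f j) ` {..<k}"
    have "dim ?S \<le> card ?S" by (rule dim_le_card') simp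
    also have "\<dots> \<le> k" using card_image_le[of "{..<k}" "\<lambda>j. P *v f j"] by simp
    also have "\<dots> < DIM(real^'n)" using Suc.prems by simp
    finally obtain x where x: "x \<noteq> 0" "\<And>y. y \<in> span ?S \<Longrightarrow> orthogonal x y"
      by (rule orthogonal_to_subspace_exists) blast
    define c where "c = sqrt (x \<bullet> (P *v x))"
    have c: "c > 0" "c * c = x \<bullet> (P *v x)"
      using spdD(2)[OF assms x(1)] by (simp_all add: c_def)
    have xf: "x \<bullet> (P *v f j) = 0" if "j < k" for j
      using x(2)[of "P *v f j"] that by (auto simp: orthogonal_def intro: span_base)
    have fx: "f j \<bullet> (P *v x) = 0" if "j < k" for j
      using xf[OF that] inner_matrix_vector_mult_left[of P "f j" x] spdD(1)[OF assms]
      by (simp add: inner_commute)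
    let ?g = "f(k := (1 / c) *\<^sub>R x)"
    have "?g i \<bullet> (P *v ?g j) = (if i = j then 1 else 0)" if "i < Suc k" "j < Suc k" for i j
      using that c f xf fx
      by (auto simp: less_Suc_eq matrix_vector_mult_scaleR field_simps)
    then show ?case by blast
  qed simp
  obtain f :: "nat \<Rightarrow> real^'n"
    where f: "\<And>i j. i < CARD('n) \<Longrightarrow> j < CARD('n) \<Longrightarrow> f i \<bullet> (P *v f j) = (if i = j then 1 else 0)"
    using ex[of "CARD('n)"] by auto
  obtain h where h: "bij_betw h (UNIV :: 'n set) {0..<CARD('n)}"
    using ex_bij_betw_finite_nat[of "UNIV :: 'n set"] by auto
  have hlt: "h i < CARD('n)" and hinj: "h i = h j \<longleftrightarrow> i = j" for i j
    using h by (auto simp: bij_betw_def inj_on_def)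
  define F where "F = (\<chi> i j. f (h j) $ i)"
  have col: "F *v axis j 1 = f (h j)" for j
    by (simp add: F_def vec_eq_iff matrix_vector_mult_basis column_def)
  have "(transpose F ** P ** F) $ i $ j = mat 1 $ i $ j" for i j
  proof -
    have "(transpose F ** P ** F) $ i $ j = axis i 1 \<bullet> ((transpose F ** P ** F) *v axis j 1)"
      by (simp add: inner_axis' matrix_vector_mult_basis column_def)
    also have "\<dots> = (F *v axis i 1) \<bullet> (P *v (F *v axis j 1))"
      by (simp add: inner_matrix_vector_mult_left matrix_vector_mul_assoc matrix_mul_assoc)
    also have "\<dots> = mat 1 $ i $ j"
      by (simp add: col f hlt hinj mat_def)
    finally show ?thesis .
  qed
  then have "transpose F ** P ** F = mat 1" by (simp add: vec_eq_iff)
  then show thesis by (rule that)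
qed

lemma det_spd_pos:
  fixes P :: "real^'n^'n"
  assumes "P \<in> spd_matrices"
  shows "0 < det P"
proof -
  obtain F :: "real^'n^'n" where "transpose F ** P ** F = mat 1" by (rule spd_congruent_to_identity[OF assms])
  then have "det F ^ 2 * det P = 1"
    by (metis det_I det_mul det_transpose mult.assoc mult.commute power2_eq_square)
  then show ?thesis
    by (metis zero_less_mult_pos zero_less_one zero_le_power2 less_eq_real_def mult_zero_left zero_neq_one)
qed

section \<open>Gaussian integrals\<close>

text \<open>
  The integrand is a product of functions of single coordinates, so Fubini reduces the claim to the
  normalisation of the standard normal density on the line.
\<close>

lemma nn_integral_std_gauss:
  "(\<integral>\<^sup>+x. ennreal (exp (- (1 / 2) * (x \<bullet> x))) \<partial>(lborel :: (real^'n) measure)) = ennreal (sqrt ((2 * pi) ^ CARD('n)))"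
proof -
  have exp_eq: "ennreal (exp (- (1 / 2) * (x \<bullet> x))) = (\<Prod>b\<in>Basis. ennreal (exp (- ((x \<bullet> b)\<^sup>2 / 2))))" for x :: "real^'n"
    by (simp add: prod_ennreal exp_sum[symmetric] euclidean_inner[of x x] power2_eq_square sum_divide_distrib sum_negf)
  have "(\<integral>\<^sup>+t. ennreal (exp (- (t\<^sup>2 / 2))) \<partial>lborel) = (\<integral>\<^sup>+t. ennreal (sqrt (2 * pi) * std_normal_density t) \<partial>lborel)"
    by (simp add: std_normal_density_def)
  also have "\<dots> = ennreal (sqrt (2 * pi))"
    by (subst nn_integral_eq_integral) auto
  finally have one_dim: "(\<integral>\<^sup>+t. ennreal (exp (- (t\<^sup>2 / 2))) \<partial>lborel) = ennreal (sqrt (2 * pi))" .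
  show ?thesis
    unfolding exp_eq real_sqrt_power
    by (subst nn_integral_lborel_prod) (simp_all add: one_dim ennreal_power del: power_mult_distrib)
qed

text \<open>
  If the columns of \<open>F\<close> are orthonormal for \<open>\<Sigma>\<close>, then \<open>\<Sigma>\<^sup>-\<^sup>1 = F F\<^sup>T\<close> and \<open>|det F| = 1 / sqrt (det \<Sigma>)\<close>. Hence the
  substitution \<open>z = F\<^sup>T (x - \<mu>)\<close> turns the exponent into \<open>- z\<^sup>T z / 2\<close>, and its Jacobian \<open>|det F|\<close> is exactly the
  factor \<open>1 / sqrt (det \<Sigma>)\<close> of the density.
\<close>

theorem has_bochner_integral_gauss_rbf:
  fixes \<mu> :: "real^'n"
  assumes "\<Sigma> \<in> spd_matrices"
  shows "has_bochner_integral lborel (\<lambda>x. gauss_rbf x \<mu> \<Sigma>) 1"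
proof -
  let ?P = "matrix_inv \<Sigma>"
  obtain F :: "real^'n^'n" where F: "transpose F ** \<Sigma> ** F = mat 1" by (rule spd_congruent_to_identity[OF assms])
  have det: "det F ^ 2 * det \<Sigma> = 1"
    using F by (metis det_I det_mul det_transpose mult.assoc mult.commute power2_eq_square)
  have "\<Sigma> ** (F ** transpose F) = mat 1"
    using F by (metis matrix_left_right_inverse matrix_mul_assoc)
  then have P: "?P = F ** transpose F" by (rule matrix_inv_eqI)
  let ?f = "\<lambda>z :: real^'n. ennreal (exp (- (1 / 2) * (z \<bullet> z)))"
  let ?C = "sqrt ((2 * pi) ^ CARD('n))"
  have quad: "x \<bullet> (?P *v x) = (transpose F *v x) \<bullet> (transpose F *v x)" for x
    by (simp add: P inner_matrix_vector_mult_left matrix_vector_mul_assoc)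
  have detF: "det (matrix ((*v) (transpose F))) = det F" by (simp add: det_transpose)
  have "det F \<noteq> 0" using det by auto
  have [measurable]: "(\<lambda>x. x - \<mu>) \<in> borel_measurable borel" "(*v) A \<in> borel_measurable borel" for A :: "real^'n^'n"
    by (simp_all add: borel_measurable_continuous_onI matrix_vector_mult_linear_continuous_on)
  have "(\<integral>\<^sup>+x. ?f (transpose F *v (x - \<mu>)) \<partial>lborel) = (\<integral>\<^sup>+x. ?f (transpose F *v x) \<partial>lborel)"
    by (subst lborel_distr_plus[of "-\<mu>", symmetric], subst nn_integral_distr) auto
  also have "ennreal \<bar>det F\<bar> * \<dots> = ennreal ?C"
    using nn_integral_lborel_linear[of "(*v) (transpose F)" ?f, unfolded detF nn_integral_std_gauss] \<open>det F \<noteq> 0\<close>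
    by simp
  finally have int: "ennreal \<bar>det F\<bar> * (\<integral>\<^sup>+x. ?f (transpose F *v (x - \<mu>)) \<partial>lborel) = ennreal ?C" .
  have "\<bar>det F\<bar> * sqrt (det \<Sigma>) = 1"
    using det by (metis real_sqrt_abs real_sqrt_mult real_sqrt_one)
  then have k: "1 / sqrt ((2 * pi) ^ CARD('n) * det \<Sigma>) = 1 / ?C * \<bar>det F\<bar>"
    using det_spd_pos[OF assms] by (simp add: real_sqrt_mult field_simps)
  have gauss: "ennreal (gauss_rbf x \<mu> \<Sigma>) = ennreal (1 / ?C) * (ennreal \<bar>det F\<bar> * ?f (transpose F *v (x - \<mu>)))" for x
    unfolding gauss_rbf_def k quad by (simp add: ennreal_mult'[symmetric])
  have "(\<integral>\<^sup>+x. ennreal (gauss_rbf x \<mu> \<Sigma>) \<partial>lborel) = ennreal (1 / ?C) * ennreal ?C"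
    unfolding gauss using int by (simp add: nn_integral_cmult)
  also have "\<dots> = 1"
    by (simp add: ennreal_mult'[symmetric])
  finally show ?thesis
    using det_spd_pos[OF assms]
    by (intro has_bochner_integral_nn_integral) (simp_all add: gauss_rbf_def)
qed

text \<open>
  Completing the square. With \<open>P = \<Sigma>\<^sup>-\<^sup>1\<close>, \<open>P\<^sub>0 = \<Sigma>\<^sub>0\<^sup>-\<^sup>1\<close>, \<open>C = (P + P\<^sub>0)\<^sup>-\<^sup>1\<close>, \<open>b = z - \<mu>\<^sub>0\<close> and \<open>d = \<mu>\<^sub>0 - \<mu>\<close>, the
  exponents are \<open>- 1 / 2\<close> times terms that add up to
  \<open>b\<^sup>T P\<^sub>0 b + (b + d)\<^sup>T P (b + d)\<close>, which is minimal at \<open>b = v = - C P d\<close>. The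
  value at the minimum is \<open>d\<^sup>T (P - P C P) d\<close>, and \<open>P - P C P = P\<^sub>0 C P = (\<Sigma> + \<Sigma>\<^sub>0)\<^sup>-\<^sup>1\<close>. The last equality, and
  the matching of the determinants, come from \<open>\<Sigma> (P + P\<^sub>0) \<Sigma>\<^sub>0 = \<Sigma> + \<Sigma>\<^sub>0\<close>.
\<close>

lemma gauss_rbf_product:
  fixes \<mu> \<mu>0 z :: "real^'n"
  assumes \<Sigma>: "\<Sigma> \<in> spd_matrices" and \<Sigma>0: "\<Sigma>0 \<in> spd_matrices"
  defines "C \<equiv> matrix_inv (matrix_inv \<Sigma> + matrix_inv \<Sigma>0)"
  defines "v \<equiv> - (C *v (matrix_inv \<Sigma> *v (\<mu>0 - \<mu>)))"
  shows "gauss_rbf z \<mu>0 \<Sigma>0 * gauss_rbf z \<mu> \<Sigma> = gauss_rbf \<mu>0 \<mu> (\<Sigma> + \<Sigma>0) * gauss_rbf z (\<mu>0 + v) C"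
proof -
  define P where "P = matrix_inv \<Sigma>"
  define P0 where "P0 = matrix_inv \<Sigma>0"
  define R where "R = matrix_inv (\<Sigma> + \<Sigma>0)"
  note spdP = spd_matrix_inv[OF \<Sigma>, folded P_def] spd_matrix_inv[OF \<Sigma>0, folded P0_def]
  note spdPP = spd_add[OF spdP]
  note invP = matrix_inv_mult[OF spd_invertible[OF \<Sigma>], folded P_def]
  note invP0 = matrix_inv_mult[OF spd_invertible[OF \<Sigma>0], folded P0_def]
  note invPP = matrix_inv_mult[OF spd_invertible[OF spdPP], folded C_def[folded P_def P0_def]]
  have Cinv: "matrix_inv C = P + P0"
    using matrix_inv_matrix_inv[OF spd_invertible[OF spdPP]] by (simp add: C_def P_def P0_def)
  have sum_inv: "\<Sigma> ** (P + P0) ** \<Sigma>0 = \<Sigma> + \<Sigma>0"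
  proof -
    have "\<Sigma> ** (P + P0) ** \<Sigma>0 = (\<Sigma> ** P) ** \<Sigma>0 + \<Sigma> ** (P0 ** \<Sigma>0)"
      by (simp add: matrix_add_ldistrib matrix_add_rdistrib matrix_mul_assoc)
    then show ?thesis by (simp add: invP invP0 add.commute)
  qed
  have R: "R = P0 ** C ** P"
    unfolding R_def
  proof (rule matrix_inv_eqI)
    have "(\<Sigma> + \<Sigma>0) ** (P0 ** C ** P) = \<Sigma> ** ((P + P0) ** (\<Sigma>0 ** P0) ** C) ** P"
      unfolding sum_inv[symmetric] by (simp add: matrix_mul_assoc)
    then show "(\<Sigma> + \<Sigma>0) ** (P0 ** C ** P) = mat 1" by (simp add: invP invP0 invPP)
  qed
  have R': "R = P - P ** C ** P"
  proof -
    have "P = (P + P0) ** C ** P" by (simp add: invPP)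
    also have "\<dots> = P ** C ** P + R" by (simp add: R matrix_add_rdistrib)
    finally show ?thesis by (simp add: algebra_simps)
  qed
  define d where "d = \<mu>0 - \<mu>"
  define b where "b = z - \<mu>0"
  have v: "v = - (C *v (P *v d))" by (simp add: v_def P_def d_def)
  have PPv: "(P + P0) *v v = - (P *v d)"
    by (simp add: v matrix_vector_mult_minus matrix_vector_mul_assoc matrix_mul_assoc invPP)
  have sym: "x \<bullet> (P *v y) = y \<bullet> (P *v x)" "x \<bullet> ((P + P0) *v y) = y \<bullet> ((P + P0) *v x)" for x y
    using inner_matrix_vector_mult_left[of P x y] inner_matrix_vector_mult_left[of "P + P0" x y]
      spdD(1)[OF spdP(1)] spdD(1)[OF spdPP] by (simp_all add: inner_commute)
  have quad: "b \<bullet> (P0 *v b) + (z - \<mu>) \<bullet> (P *v (z - \<mu>)) =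
      d \<bullet> (R *v d) + (z - (\<mu>0 + v)) \<bullet> ((P + P0) *v (z - (\<mu>0 + v)))"
  proof -
    have "z - \<mu> = b + d" by (simp add: b_def d_def)
    then have "(z - \<mu>) \<bullet> (P *v (z - \<mu>)) = b \<bullet> (P *v b) + 2 * (b \<bullet> (P *v d)) + d \<bullet> (P *v d)"
      using sym(1)[of b d] by (simp add: matrix_vector_right_distrib inner_add_left inner_add_right)
    moreover have "(z - (\<mu>0 + v)) \<bullet> ((P + P0) *v (z - (\<mu>0 + v))) =
        b \<bullet> ((P + P0) *v b) - 2 * (b \<bullet> ((P + P0) *v v)) + v \<bullet> ((P + P0) *v v)"
    proof -
      have zv: "z - (\<mu>0 + v) = b - v" by (simp add: b_def)
      show ?thesis
        unfolding zv using sym(2)[of b v] by (simp add: matrix_vector_mult_diff_distrib inner_diff_left inner_diff_right)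
    qed
    moreover have "d \<bullet> (R *v d) = d \<bullet> (P *v d) + v \<bullet> (P *v d)"
      using sym(1)[of v d]
      by (simp add: R' v matrix_vector_mult_diff_rdistrib inner_diff_right matrix_vector_mul_assoc
          matrix_mul_assoc matrix_vector_mult_minus)
    ultimately show ?thesis
      unfolding PPv by (simp add: matrix_vector_mult_add_rdistrib inner_add_right)
  qed
  have "det (P + P0) * det C = 1"
    using invPP(1) by (metis det_I det_mul)
  then have dets: "det \<Sigma>0 * det \<Sigma> = det (\<Sigma> + \<Sigma>0) * det C"
    unfolding sum_inv[symmetric] det_mul by simp
  have "sqrt (a * det \<Sigma>0) * sqrt (a * det \<Sigma>) = sqrt (a * det (\<Sigma> + \<Sigma>0)) * sqrt (a * det C)" for a
    using dets by (simp add: real_sqrt_mult[symmetric] ac_simps)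
  then have norm: "1 / sqrt (a * det \<Sigma>0) * (1 / sqrt (a * det \<Sigma>)) =
      1 / sqrt (a * det (\<Sigma> + \<Sigma>0)) * (1 / sqrt (a * det C))" for a
    by simp
  have exps: "exp (- (1 / 2) * (b \<bullet> (P0 *v b))) * exp (- (1 / 2) * ((z - \<mu>) \<bullet> (P *v (z - \<mu>)))) =
      exp (- (1 / 2) * (d \<bullet> (R *v d))) * exp (- (1 / 2) * ((z - (\<mu>0 + v)) \<bullet> ((P + P0) *v (z - (\<mu>0 + v)))))"
    unfolding exp_add[symmetric] using quad by (simp add: algebra_simps)
  have regroup: "(p * q) * (r * s) = (p * r) * (q * s)" for p q r s :: real by simp
  show ?thesis
    unfolding gauss_rbf_def Cinv P_def[symmetric] P0_def[symmetric] R_def[symmetric]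
      d_def[symmetric] b_def[symmetric]
    by (rule trans[OF regroup trans[OF arg_cong2[where f="(*)", OF norm exps] regroup]])
qed

corollary has_bochner_integral_gauss_rbf_product:
  fixes \<mu> \<mu>0 :: "real^'n"
  assumes \<Sigma>: "\<Sigma> \<in> spd_matrices" and \<Sigma>0: "\<Sigma>0 \<in> spd_matrices"
  shows "has_bochner_integral lborel (\<lambda>z. gauss_rbf z \<mu>0 \<Sigma>0 * gauss_rbf z \<mu> \<Sigma>) (gauss_rbf \<mu>0 \<mu> (\<Sigma> + \<Sigma>0))"
proof -
  have "matrix_inv (matrix_inv \<Sigma> + matrix_inv \<Sigma>0) \<in> spd_matrices"
    using \<Sigma> \<Sigma>0 by (intro spd_matrix_inv spd_add)
  note int = has_bochner_integral_mult_right[OF has_bochner_integral_gauss_rbf[OF this]]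
  show ?thesis unfolding gauss_rbf_product[OF \<Sigma> \<Sigma>0] using int by simp
qed

section \<open>Block matrices and the matrix inequalities of the program\<close>

lemma inner_stack: "stack a b \<bullet> stack c d = a \<bullet> c + b \<bullet> d"
  by (simp add: stack_def inner_vec_def sum_UNIV_Plus)

lemma stack_eq_iff: "stack a b = stack c d \<longleftrightarrow> a = c \<and> b = d"
  by (auto simp: stack_def vec_eq_iff split: sum.splits) 

lemma block2_mult_stack: "block2 A B C D *v stack x y = stack (A *v x + B *v y) (C *v x + D *v y)"
  by (auto simp: block2_def stack_def vec_eq_iff matrix_vector_mult_def sum_UNIV_Plus split: sum.splits)

lemma block3_mult_stack:
  "block3 A B C D E F G H I *v stack (stack x y) z =
     stack (stack (A *v x + B *v y + C *v z) (D *v x + E *v y + F *v z)) (G *v x + H *v y + I *v z)"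
  by (auto simp: block3_def stack_def vec_eq_iff matrix_vector_mult_def sum_UNIV_Plus split: sum.splits)

lemma scalar_block_mult: "scalar_block c *v x = c *\<^sub>R x"
  by (simp add: scalar_block_def vec_eq_iff matrix_vector_mult_def mat_def UNIV_unit)

lemma columnvector_mult_1: "columnvector x *v (1 :: real^unit) = x"
  by (simp add: columnvector_def vec_eq_iff matrix_vector_mult_def UNIV_unit)

lemma rowvector_mult: "rowvector x *v y = (vec (x \<bullet> y) :: real^unit)"
  by (simp add: rowvector_def vec_eq_iff matrix_vector_mult_def inner_vec_def)

text \<open>
  For fixed \<open>z\<close> the quadratic form of the block matrix is minimal over its first argument at
  \<open>p = - D G z\<close>, where it equals \<open>z\<^sup>T R z - (G z)\<^sup>T D (G z)\<close>. Evaluating at this \<open>p\<close> gives the bound.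
\<close>

lemma psd_block2_schur:
  fixes D :: "real^'r^'r" and G :: "real^'c^'r"
  assumes "psd (block2 (matrix_inv D) G (transpose G) R)" and "invertible D"
  shows "(G *v z) \<bullet> (D *v (G *v z)) \<le> z \<bullet> (R *v z)"
proof -
  let ?g = "G *v z"
  let ?p = "- (D *v ?g)"
  have "matrix_inv D *v ?p = - ?g"
    by (simp add: matrix_vector_mult_minus matrix_vector_mul_assoc matrix_mul_assoc matrix_inv_mult[OF assms(2)])
  moreover have "z \<bullet> (transpose G *v ?p) = ?g \<bullet> ?p"
    by (simp only: inner_matrix_vector_mult_left)
  moreover have "0 \<le> stack ?p z \<bullet> (block2 (matrix_inv D) G (transpose G) R *v stack ?p z)"
    using assms(1) by (simp add: psd_def)
  ultimately show ?thesis
    by (simp add: block2_mult_stack inner_stack inner_add_right inner_commute)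
qed

lemma invertible_Q_Sigmahat:
  fixes \<Sigma>h :: "real^'n^'n"
  assumes "\<Sigma>h \<in> spd_matrices"
  shows "invertible (Q_Sigmahat \<Sigma>h :: real^((unit + 'm::finite) + 'n)^((unit + 'm) + 'n))"
    (is "invertible ?D")
proof -
  have "p = 0" if "?D *v p = 0" for p
  proof -
    obtain a b c where p: "p = stack (stack a b) c"
    proof
      show "p = stack (stack (\<chi> i. p $ Inl (Inl i)) (\<chi> i. p $ Inl (Inr i))) (\<chi> i. p $ Inr i)"
        by (auto simp: stack_def vec_eq_iff split: sum.splits)
    qed
    have 0: "stack (stack 0 0) 0 = (0 :: real^((unit + 'm) + 'n))"
      by (auto simp: stack_def vec_eq_iff split: sum.splits)
    have "a = 0" "b = 0" "matrix_inv \<Sigma>h *v c = 0"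
      using that unfolding p by (simp_all add: Q_Sigmahat_def block3_mult_stack stack_eq_iff flip: 0)
    moreover from this have "c = 0"
      using spdD(2)[OF spd_matrix_inv[OF assms], of c] by (cases "c = 0") auto
    ultimately show ?thesis by (simp add: p 0)
  qed
  then show ?thesis by (simp add: invertible_left_inverse matrix_left_invertible_ker)
qed

lemma homog_stack: "homog (stack x u) = stack (stack x u) 1"
  by (simp add: homog_def)

text \<open>
  The Schur complement bound at \<open>z = [x; u; 1]\<close>: the matrix \<open>Q_muhat \<mu>h\<close> maps this vector to \<open>[0; 0; x - \<mu>h]\<close>,
  on which the form of \<open>Q_Sigmahat \<Sigma>h\<close> is the one of \<open>matrix_inv \<Sigma>h\<close>.
\<close>

lemma mahalanobis_le_corner:
  fixes x \<mu>h :: "real^'n" and u :: "real^'m::finite"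
  assumes "psd (block2 (matrix_inv (Q_Sigmahat \<Sigma>h :: real^((unit + 'm) + 'n)^((unit + 'm) + 'n)))
                 (Q_muhat \<mu>h) (transpose (Q_muhat \<mu>h)) R)" and "\<Sigma>h \<in> spd_matrices"
  shows "(x - \<mu>h) \<bullet> (matrix_inv \<Sigma>h *v (x - \<mu>h)) \<le> homog (stack x u) \<bullet> (R *v homog (stack x u))"
proof -
  have G: "Q_muhat \<mu>h *v homog (stack x u) = (stack (stack 0 0) (x - \<mu>h) :: real^((unit + 'm) + 'n))"
    by (simp add: Q_muhat_def homog_stack block3_mult_stack matrix_vector_mult_minus columnvector_mult_1)
  show ?thesis
    using psd_block2_schur[OF assms(1) invertible_Q_Sigmahat[OF assms(2)], of "homog (stack x u)"]
    by (simp add: G Q_Sigmahat_def block3_mult_stack inner_stack)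
qed

lemma quadratic_form_scalar_corner:
  "homog (stack x u) \<bullet> (block3 0 0 0 0 0 0 0 0 (scalar_block c) *v homog (stack x u)) = c"
  by (simp add: homog_stack block3_mult_stack inner_stack scalar_block_mult) (simp add: inner_vec_def)

text \<open>
  The matrix is \<open>F\<^sup>T S F\<close> for the block row \<open>F = [A, B, - \<mu>]\<close>, and \<open>F [x; u; 1] = A x + B u - \<mu>\<close>.
\<close>

lemma quadratic_form_Q_mu_Sigmabar:
  fixes A :: "real^'n^'n" and B :: "real^'m^'n"
  shows "homog (stack x u) \<bullet> (Q_mu_Sigmabar A B \<mu> S *v homog (stack x u)) =
    (A *v x + B *v u - \<mu>) \<bullet> (S *v (A *v x + B *v u - \<mu>))"
proof -
  let ?e = "A *v x + B *v u - \<mu>"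
  have "Q_mu_Sigmabar A B \<mu> S *v homog (stack x u) =
    stack (stack (transpose A *v (S *v ?e)) (transpose B *v (S *v ?e))) (vec (- (\<mu> \<bullet> (S *v ?e))))"
    unfolding Q_mu_Sigmabar_def homog_stack block3_mult_stack stack_eq_iff
    by (simp add: matrix_vector_mul_assoc[symmetric] matrix_vector_mult_minus columnvector_mult_1 rowvector_mult
        matrix_vector_mult_diff_distrib matrix_vector_right_distrib inner_add_right inner_diff_right vec_eq_iff)
  then show ?thesis
    by (simp add: homog_stack inner_stack inner_matrix_vector_mult_left[symmetric] inner_add_left inner_diff_left)
      (simp add: inner_vec_def)
qed

lemma quadratic_form_sum_diff:
  fixes R :: "real^'d^'d" and N :: nat
  shows "z \<bullet> ((R - (\<Sum>j=1..N. \<tau> j *\<^sub>R S j)) *v z) = z \<bullet> (R *v z) - (\<Sum>j=1..N. \<tau> j * (z \<bullet> (S j *v z)))"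
proof -
  have "(\<Sum>j=1..N. \<tau> j *\<^sub>R S j) *v z = (\<Sum>j=1..N. \<tau> j *\<^sub>R (S j *v z))"
    by (induction N) (simp_all add: matrix_vector_mult_add_rdistrib scaleR_matrix_vector_assoc)
  then show ?thesis
    by (simp add: matrix_vector_mult_diff_rdistrib inner_diff_right inner_sum_right)
qed

section \<open>Feasibility of the candidate\<close>

lemma gauss_rbf_nonneg:
  assumes "\<Sigma> \<in> spd_matrices"
  shows "0 \<le> gauss_rbf x \<mu> \<Sigma>"
  using det_spd_pos[OF assms] by (simp add: gauss_rbf_def)

text \<open>
  In this form an inequality between weighted Gaussians is one between exponents, which are quadratic
  polynomials. The logarithm is the constant that appears in \<open>Q_mat\<close>, where \<open>\<Sigma> + \<Sigma>0\<close> takes the place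
  of \<open>\<Sigma>\<close>.
\<close>

lemma weighted_gauss_rbf_eq_exp:
  fixes x \<mu> :: "real^'n"
  assumes "\<Sigma> \<in> spd_matrices" and "0 < w"
  shows "w * gauss_rbf x \<mu> \<Sigma> =
    exp (- ln (sqrt (det \<Sigma>) / w) - 1 / 2 * ((x - \<mu>) \<bullet> (matrix_inv \<Sigma> *v (x - \<mu>)))) / sqrt ((2 * pi) ^ CARD('n))"
proof -
  have "exp (- ln (sqrt (det \<Sigma>) / w)) = w / sqrt (det \<Sigma>)"
    using det_spd_pos[OF assms(1)] assms(2) by (simp add: exp_minus)
  then have "exp (- ln (sqrt (det \<Sigma>) / w) - h) = w / sqrt (det \<Sigma>) * exp (- h)" for h
    by (simp add: exp_diff exp_minus[of h] divide_inverse)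
  then show ?thesis
    by (simp add: gauss_rbf_def real_sqrt_mult)
qed

lemma has_bochner_integral_gauss_rbf_mult_rbf_sum:
  fixes \<Sigma>0 :: "real^'n^'n"
  assumes "\<And>i. i \<in> {1..M} \<Longrightarrow> \<Sigma> i \<in> spd_matrices" and "\<Sigma>0 \<in> spd_matrices"
  shows "has_bochner_integral lborel (\<lambda>z. gauss_rbf z m \<Sigma>0 * rbf_sum M w \<mu> \<Sigma> z)
           (\<Sum>i=1..M. w i * gauss_rbf m (\<mu> i) (\<Sigma> i + \<Sigma>0))"
proof -
  have "has_bochner_integral lborel (\<lambda>z. \<Sum>i=1..M. w i * (gauss_rbf z m \<Sigma>0 * gauss_rbf z (\<mu> i) (\<Sigma> i)))
           (\<Sum>i=1..M. w i * gauss_rbf m (\<mu> i) (\<Sigma> i + \<Sigma>0))"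
    using assms
    by (intro has_bochner_integral_sum has_bochner_integral_mult_right has_bochner_integral_gauss_rbf_product) auto
  then show ?thesis
    by (simp add: rbf_sum_def sum_distrib_left mult.left_commute)
qed

theorem proposition7:
  fixes U :: "(real^'m) set"
    and K K' Xbar :: "(real^'n) set"
    and Km :: "nat \<Rightarrow> real^('n + unit)^('n + unit)"
    and Sm :: "nat \<Rightarrow> real^(('n + 'm) + unit)^(('n + 'm) + unit)"
    and A \<Sigma>0 :: "real^'n^'n"
    and B :: "real^'m^'n"
    and Q :: "real^'n \<Rightarrow> real^'m \<Rightarrow> (real^'n) measure"
    and N T k M :: nat
    and w :: "nat \<Rightarrow> real"
    and \<mu> :: "nat \<Rightarrow> real^'n"
    and \<Sigma> :: "nat \<Rightarrow> real^'n^'n"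
    and \<nu> :: "(real^'n) measure"
    and \<mu>h :: "nat \<Rightarrow> real^'n"
    and \<Sigma>h :: "nat \<Rightarrow> real^'n^'n"
    and y :: "nat \<Rightarrow> real"
    and \<tau> \<rho> :: "nat \<Rightarrow> nat \<Rightarrow> real"
  assumes "compact U"
    and "K \<in> sets borel" and "K' \<in> sets borel" and "K \<subseteq> K'" and "bounded K"
    and "Xbar = K' - K"
    and "describes_quadratic_set N Km K"
    and "describes_quadratic_set N Sm ((\<lambda>(x, u). stack x u) ` (Xbar \<times> U))"
    and "stochastic_kernel U Q"
    and "\<And>x C. C \<in> sets borel \<Longrightarrow> continuous_on U (\<lambda>u. measure (Q x u) C)"
    and "\<Sigma>0 \<in> spd_matrices"
    and "\<And>x u. u \<in> U \<Longrightarrow> Q x u = density lborel (\<lambda>z. ennreal (gauss_rbf z (A *v x + B *v u) \<Sigma>0))"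
    and "k < T"
    and "1 \<le> M"
    and "\<And>i. i \<in> {1..M} \<Longrightarrow> 0 < w i"
    and "\<And>i. i \<in> {1..M} \<Longrightarrow> \<Sigma> i \<in> spd_matrices"
    and "\<And>x. reach_avoid_value U K Xbar Q T (k + 1) x \<le> rbf_sum M w \<mu> \<Sigma> x"
    and "prob_space \<nu>" and "sets \<nu> = sets borel"
    and "optimal_solution (sdp_problem A B \<Sigma>0 N Km Sm M w \<mu> \<Sigma>) (\<mu>h, \<Sigma>h, y, \<tau>, \<rho>)"
  shows "feasible_solution (reach_avoid_problem M \<nu> K Xbar U Q (rbf_sum M w \<mu> \<Sigma>))
           (rbf_sum M (\<lambda>i. exp (y i) * sqrt (det (\<Sigma>h i))) \<mu>h \<Sigma>h)"
proof -
  let ?wh = "\<lambda>i. exp (y i) * sqrt (det (\<Sigma>h i))"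
  let ?C = "sqrt ((2 * pi) ^ CARD('n))"
  have psdX: "psd (X_mat A B \<Sigma>0 N Sm (w i) (\<mu> i) (\<Sigma> i) (\<mu>h i) (\<Sigma>h i) (y i) (\<tau> i))"
    and psdXbar: "psd (Xbar_mat M N Km (\<mu>h i) (\<Sigma>h i) (y i) (\<rho> i)
               :: real^(((unit + 'm) + 'n) + (('n + 'm) + unit))^(((unit + 'm) + 'n) + (('n + 'm) + unit)))"
    and multipliers: "\<And>j. j \<in> {1..N} \<Longrightarrow> 0 \<le> \<tau> i j \<and> 0 \<le> \<rho> i j"
    and spd: "\<Sigma>h i \<in> spd_matrices" if "i \<in> {1..M}" for i
    using assms(20) that by (auto simp: optimal_solution_def feasible_solution_def sdp_problem_def)
  let ?q = "\<lambda>i x. (x - \<mu>h i) \<bullet> (matrix_inv (\<Sigma>h i) *v (x - \<mu>h i))"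
  \<comment> \<open>The weight cancels the determinant, so no logarithm of \<open>det (\<Sigma>h i)\<close> remains in the exponent.\<close>
  have weighted: "?wh i * gauss_rbf x (\<mu>h i) (\<Sigma>h i) = exp (y i - 1 / 2 * ?q i x) / ?C" if i: "i \<in> {1..M}" for i x
  proof -
    have "- ln (sqrt (det (\<Sigma>h i)) / ?wh i) = y i"
      using det_spd_pos[OF spd[OF i]] by (simp add: ln_div)
    then show ?thesis
      using weighted_gauss_rbf_eq_exp[OF spd[OF i], of "?wh i" x "\<mu>h i"] det_spd_pos[OF spd[OF i]] by simp
  qed
  have dominates: "w i * gauss_rbf (A *v x + B *v u) (\<mu> i) (\<Sigma> i + \<Sigma>0) \<le> ?wh i * gauss_rbf x (\<mu>h i) (\<Sigma>h i)"
    if i: "i \<in> {1..M}" and xu: "x \<in> Xbar" "u \<in> U" for i x u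
  proof -
    let ?z = "homog (stack x u)" and ?e = "A *v x + B *v u - \<mu> i"
    have "?q i x \<le> ?z \<bullet> ((Q_mat \<Sigma>0 (w i) (\<Sigma> i) (y i) + Q_mu_Sigmabar A B (\<mu> i) (matrix_inv (\<Sigma> i + \<Sigma>0))
        - (\<Sum>j=1..N. \<tau> i j *\<^sub>R Sm j)) *v ?z)"
      by (rule mahalanobis_le_corner[OF psdX[OF i, unfolded X_mat_def] spd[OF i]])
    also have "\<dots> = 2 * (y i + ln (sqrt (det (\<Sigma> i + \<Sigma>0)) / w i)) + ?e \<bullet> (matrix_inv (\<Sigma> i + \<Sigma>0) *v ?e)
        - (\<Sum>j=1..N. \<tau> i j * (?z \<bullet> (Sm j *v ?z)))"
      unfolding quadratic_form_sum_diff matrix_vector_mult_add_rdistrib inner_add_right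
        quadratic_form_Q_mu_Sigmabar Q_mat_def quadratic_form_scalar_corner ..
    finally have bound: "?q i x \<le> \<dots>" .
    have "0 \<le> (\<Sum>j=1..N. \<tau> i j * (?z \<bullet> (Sm j *v ?z)))"
    proof (rule sum_nonneg)
      fix j assume j: "j \<in> {1..N}"
      have "stack x u \<in> quadratic_set N Sm"
        using assms(8) xu by (auto simp: describes_quadratic_set_def)
      then show "0 \<le> \<tau> i j * (?z \<bullet> (Sm j *v ?z))"
        using j multipliers[OF i j] by (simp add: quadratic_set_def)
    qed
    with bound have le: "- ln (sqrt (det (\<Sigma> i + \<Sigma>0)) / w i) - 1 / 2 * (?e \<bullet> (matrix_inv (\<Sigma> i + \<Sigma>0) *v ?e))
        \<le> y i - 1 / 2 * ?q i x" by simp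
    have "w i * gauss_rbf (A *v x + B *v u) (\<mu> i) (\<Sigma> i + \<Sigma>0) =
        exp (- ln (sqrt (det (\<Sigma> i + \<Sigma>0)) / w i) - 1 / 2 * (?e \<bullet> (matrix_inv (\<Sigma> i + \<Sigma>0) *v ?e))) / ?C"
      by (rule weighted_gauss_rbf_eq_exp[OF spd_add[OF assms(16)[OF i] assms(11)] assms(15)[OF i]])
    also have "\<dots> \<le> exp (y i - 1 / 2 * ?q i x) / ?C"
      using le by (intro divide_right_mono) simp_all
    finally show ?thesis unfolding weighted[OF i] .
  qed
  have at_least: "1 / M \<le> ?wh i * gauss_rbf x (\<mu>h i) (\<Sigma>h i)" if i: "i \<in> {1..M}" and x: "x \<in> K" for i x
  proof -
    \<comment> \<open>The padded matrices ignore the \<open>u\<close>-block, so any value of \<open>u\<close> can be inserted.\<close>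
    let ?z = "homog (stack x (0 :: real^'m))"
    have "?q i x \<le> ?z \<bullet> ((Qbar_mat M (y i) - (\<Sum>j=1..N. \<rho> i j *\<^sub>R pad_u (Km j))) *v ?z)"
      by (rule mahalanobis_le_corner[OF psdXbar[OF i, unfolded Xbar_mat_def] spd[OF i]])
    also have "\<dots> = 2 * (y i + ln (M / ?C)) - (\<Sum>j=1..N. \<rho> i j * (homog x \<bullet> (Km j *v homog x)))"
      unfolding quadratic_form_sum_diff Qbar_mat_def quadratic_form_scalar_corner quadratic_form_pad_u ..
    finally have bound: "?q i x \<le> \<dots>" .
    have "0 \<le> (\<Sum>j=1..N. \<rho> i j * (homog x \<bullet> (Km j *v homog x)))"
    proof (rule sum_nonneg)
      fix j assume j: "j \<in> {1..N}"
      have "x \<in> quadratic_set N Km"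
        using assms(7) x by (auto simp: describes_quadratic_set_def)
      then show "0 \<le> \<rho> i j * (homog x \<bullet> (Km j *v homog x))"
        using j multipliers[OF i j] by (simp add: quadratic_set_def)
    qed
    with bound have "- ln (M / ?C) \<le> y i - 1 / 2 * ?q i x" by simp
    moreover have "exp (- ln (M / ?C)) = ?C / M"
      using assms(14) by (simp add: exp_minus)
    ultimately have "?C / M \<le> exp (y i - 1 / 2 * ?q i x)"
      by (metis exp_le_cancel_iff)
    then have "?C / M / ?C \<le> exp (y i - 1 / 2 * ?q i x) / ?C"
      by (rule divide_right_mono) simp
    then show ?thesis unfolding weighted[OF i] by simp
  qed
  have "(\<integral>z. rbf_sum M w \<mu> \<Sigma> z \<partial>Q x u) \<le> rbf_sum M ?wh \<mu>h \<Sigma>h x" if xu: "x \<in> Xbar" "u \<in> U" for x u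
  proof -
    let ?m = "A *v x + B *v u"
    have [measurable]: "(\<lambda>z. gauss_rbf z \<mu>' \<Sigma>') \<in> borel_measurable borel" if "\<Sigma>' \<in> spd_matrices" for \<mu>' :: "real^'n" and \<Sigma>'
      using borel_measurable_has_bochner_integral[OF has_bochner_integral_gauss_rbf[OF that]] by simp
    have "rbf_sum M w \<mu> \<Sigma> \<in> borel_measurable borel"
      unfolding rbf_sum_def using assms(16) by measurable
    then have "(\<integral>z. rbf_sum M w \<mu> \<Sigma> z \<partial>Q x u) = (\<integral>z. gauss_rbf z ?m \<Sigma>0 * rbf_sum M w \<mu> \<Sigma> z \<partial>lborel)"
      using assms(11) by (simp add: assms(12)[OF xu(2)] integral_density gauss_rbf_nonneg)
    also have "\<dots> = (\<Sum>i=1..M. w i * gauss_rbf ?m (\<mu> i) (\<Sigma> i + \<Sigma>0))"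
      using assms(11,16)
      by (intro has_bochner_integral_integral_eq has_bochner_integral_gauss_rbf_mult_rbf_sum) auto
    also have "\<dots> \<le> rbf_sum M ?wh \<mu>h \<Sigma>h x"
      unfolding rbf_sum_def by (intro sum_mono dominates xu)
    finally show ?thesis .
  qed
  moreover have "1 \<le> rbf_sum M ?wh \<mu>h \<Sigma>h x" if "x \<in> K" for x
  proof -
    have "1 = (\<Sum>i=1..M. 1 / real M)" using assms(14) by simp
    also have "\<dots> \<le> rbf_sum M ?wh \<mu>h \<Sigma>h x"
      unfolding rbf_sum_def by (intro sum_mono at_least that)
    finally show ?thesis .
  qed
  moreover have "rbf_sum M ?wh \<mu>h \<Sigma>h \<in> rbf_sums M"
    unfolding rbf_sums_def using spd by blast
  ultimately show ?thesis
    by (simp add: feasible_solution_def reach_avoid_problem_def)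
qed

end
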